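(* Let $x\in\mathbb{R}^N$ be a signal with $K$-term $\ell_1$-approximation error $e_0(K)=K^{-1/2}\,\|x-x_K\|_1$, for $1\leq K\leq N$, where $x_K$ is the best $K$-term $\ell_2$-approximation of $x$. Let $2\leq p<\infty$ and let $\Phi\in\mathbb{R}^{m\times N}$ be an RIP$_{p,2}$ matrix on $s$-sparse signals with constants $\delta_s$, for $s\in\{K,2K,3K\}$. Given a measurement vector $y=\Phi x+n$ corrupted by a noise $n\in\mathbb{R}^m$ with bounded $\ell_p$-norm, i.e. $\|n\|_p\leq\epsilon$, the solution $x_p^*=\Delta_p(y,\epsilon)$ of the BPDQ$_p$ program obeys $$\|x_p^*-x\|_2\ \leq\ A_p\,e_0(K)\ +\ B_p\,\frac{\epsilon}{\mu_{p,2}},$$ for the values $$A_p=A_p(\Phi,K)=\frac{2(1+C_p-\delta_{2K})}{1-\delta_{2K}-C_p},\qquad B_p=B_p(\Phi,K)=\frac{4\sqrt{1+\delta_{2K}}}{1-\delta_{2K}-C_p},$$ where $$C_p=C_p(\Phi,2K,K)=\min\Big\{\big[(\delta_{2K}+\delta_{3K})\big(\delta_{K}+\delta_{3K}+(p-2)(1+\delta_{K})\big)\big]^{1/2},\ \big[\big(\delta_{3K}+(p-2)\tfrac{1+\delta_{3K}}{2}\big)\big(\delta_{3K}+(p-2)\tfrac{2+\delta_{K}+\delta_{3K}}{2}\big)\big]^{1/2}\Big\}.$$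
   Context: A vector is $s$-sparse if it has at most $s$ nonzero entries. The best $K$-term $\ell_2$-approximation $x_K$ of $x$ is a $K$-sparse vector minimizing $\|x-u\|_2$ over $K$-sparse $u$ (i.e. $x$ restricted to $K$ entries of largest magnitude). $\|u\|_p=(\sum_i|u_i|^p)^{1/p}$. RIP$_{p,2}$: a matrix $\Phi\in\mathbb{R}^{m\times N}$ satisfies the RIP$_{p,2}$ of order $s$ and radius (constant) $\delta_s\in(0,1)$ if there is a constant $\mu_{p,2}>0$ such that, for all $s$-sparse $u\in\mathbb{R}^N$, $$\mu_{p,2}\,(1-\delta_s)^{1/2}\,\|u\|_2\leq\|\Phi u\|_p\leq\mu_{p,2}\,(1+\delta_s)^{1/2}\,\|u\|_2 .$$ The same $\mu_{p,2}$ is used for all orders $s$ considered. BPDQ$_p$ (Basis Pursuit DeQuantizer of moment $p$): $\Delta_p(y,\epsilon)=\operatorname{argmin}_{u\in\mathbb{R}^N}\|u\|_1$ subject to $\|y-\Phi u\|_p\leq\epsilon$, with $\epsilon>0$.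
   Formalization: The formal theorem additionally assumes 1-δ_{2K}-C_p > 0, the common denominator of A_p and B_p; if it is negative the right-hand side is negative and the claim always fails, and if it is zero the constants are undefined. *)

theory Defs
  imports "HOL-Analysis.Analysis"
begin

text \<open>
  The Euclidean norm is the library's \<open>norm\<close> on \<open>real ^ 'n\<close>.
\<close>

definition lp_norm :: "real \<Rightarrow> real ^ 'n \<Rightarrow> real" where
  "lp_norm p u = (\<Sum>i\<in>UNIV. \<bar>u $ i\<bar> powr p) powr (1 / p)"

lemma lp_norm_2_eq_norm: "lp_norm 2 u = norm u"
  by (simp add: lp_norm_def norm_vec_def L2_set_def powr_half_sqrt sum_nonneg)

definition sparse :: "nat \<Rightarrow> real ^ 'n \<Rightarrow> bool" where
  "sparse s u \<longleftrightarrow> card {i. u $ i \<noteq> 0} \<le> s"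

text \<open>
  Best approximations need not be unique (ties between magnitudes), so this is a relation.
\<close>

definition best_approx :: "nat \<Rightarrow> real ^ 'n \<Rightarrow> real ^ 'n \<Rightarrow> bool" where
  "best_approx K x xK \<longleftrightarrow> is_arg_min (\<lambda>u. norm (x - u)) (sparse K) xK"

definition approx_error :: "nat \<Rightarrow> real ^ 'n \<Rightarrow> real ^ 'n \<Rightarrow> real" where
  "approx_error K x xK = real K powr (- 1 / 2) * lp_norm 1 (x - xK)"

text \<open>
  The scaling constant \<open>\<mu>\<close> is an explicit argument rather than existentially bound,
  since the same \<open>\<mu>\<close> has to serve several orders \<open>s\<close>.
\<close>

definition RIP :: "real \<Rightarrow> real ^ 'n ^ 'm \<Rightarrow> real \<Rightarrow> nat \<Rightarrow> real \<Rightarrow> bool" where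
  "RIP p \<Phi> \<mu> s \<delta> \<longleftrightarrow> 0 < \<mu> \<and> 0 < \<delta> \<and> \<delta> < 1 \<and>
     (\<forall>u. sparse s u \<longrightarrow>
        \<mu> * sqrt (1 - \<delta>) * norm u \<le> lp_norm p (\<Phi> *v u) \<and>
        lp_norm p (\<Phi> *v u) \<le> \<mu> * sqrt (1 + \<delta>) * norm u)"

text \<open>
  The argmin is rendered as the set of all minimizers.
\<close>

definition BPDQ :: "real \<Rightarrow> real ^ 'n ^ 'm \<Rightarrow> real ^ 'm \<Rightarrow> real \<Rightarrow> (real ^ 'n) set" where
  "BPDQ p \<Phi> y \<epsilon> = {u. is_arg_min (lp_norm 1) (\<lambda>u. lp_norm p (y - \<Phi> *v u) \<le> \<epsilon>) u}"

text \<open>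
  In the following constants, \<open>\<delta> s\<close> is the RIP radius of order \<open>s\<close>.
  \<open>A_const\<close> and \<open>B_const\<close> bound an error only when their common denominator is positive;
  otherwise they can be negative, or \<open>0\<close> by the convention for division by \<open>0\<close>.
\<close>

definition C_const :: "real \<Rightarrow> (nat \<Rightarrow> real) \<Rightarrow> nat \<Rightarrow> real" where
  "C_const p \<delta> K = min
     (sqrt ((\<delta> (2*K) + \<delta> (3*K)) * (\<delta> K + \<delta> (3*K) + (p - 2) * (1 + \<delta> K))))
     (sqrt ((\<delta> (3*K) + (p - 2) * ((1 + \<delta> (3*K)) / 2)) *
            (\<delta> (3*K) + (p - 2) * ((2 + \<delta> K + \<delta> (3*K)) / 2))))"

definition A_const :: "real \<Rightarrow> (nat \<Rightarrow> real) \<Rightarrow> nat \<Rightarrow> real" where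
  "A_const p \<delta> K = 2 * (1 + C_const p \<delta> K - \<delta> (2*K)) / (1 - \<delta> (2*K) - C_const p \<delta> K)"

definition B_const :: "real \<Rightarrow> (nat \<Rightarrow> real) \<Rightarrow> nat \<Rightarrow> real" where
  "B_const p \<delta> K = 4 * sqrt (1 + \<delta> (2*K)) / (1 - \<delta> (2*K) - C_const p \<delta> K)"

end

theory Submission
  imports Defs
begin

text \<open>
  The argument follows the classical stability proof for basis pursuit, with one change. Write
  \<open>h = x_star - x\<close>. Feasibility of both \<open>x\<close> and \<open>x_star\<close> gives \<open>lp_norm p (\<Phi> *v h) \<le> 2 * \<epsilon>\<close>, and
  minimality of the \<open>\<ell>\<^sub>1\<close> norm puts \<open>h\<close> in a cone: off the support \<open>T0\<close> of \<open>xK\<close> its \<open>\<ell>\<^sub>1\<close> mass is at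
  most the mass on \<open>T0\<close> plus twice the tail of \<open>x\<close> (\<open>l1_cone_inequality\<close>). Sorting the entries of
  \<open>h\<close> off \<open>T0\<close> into blocks of size \<open>K\<close> by decreasing magnitude (\<open>block_decomposition\<close>) writes
  \<open>h = u + \<Sum>v\<^sub>j\<close>, where \<open>u\<close> is supported on \<open>T0\<close> and the first
  block, the \<open>v\<^sub>j\<close> are the other blocks, and the norms of the \<open>v\<^sub>j\<close> add up to at most \<open>norm u\<close> plus
  twice the approximation error.

  For \<open>p = 2\<close> one bounds \<open>norm (\<Phi> *v u)\<close> by pairing \<open>\<Phi> *v u\<close> with \<open>\<Phi> *v h - \<Sum>\<Phi> *v v\<^sub>j\<close> and showing that
  images of disjointly supported sparse vectors are almost orthogonal. For general \<open>p\<close> there is no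
  inner product; its place is taken by the duality map \<open>J\<close>, half the gradient of the squared
  \<open>\<ell>\<^sub>p\<close> norm, which satisfies \<open>J a \<bullet> a = (lp_norm p a)\<^sup>2\<close> and Hoelder's inequality
  \<open>J a \<bullet> b \<le> lp_norm p a * lp_norm p b\<close>. The polarization identity is replaced by the
  2-smoothness inequality (\<open>lp_norm_smooth\<close>)
  \<open>(lp_norm p (a + b))\<^sup>2 \<le> (lp_norm p a)\<^sup>2 + 2 * (J a \<bullet> b) + (p - 1) * (lp_norm p b)\<^sup>2\<close> for \<open>2 \<le> p\<close>:
  along a line the squared norm has second derivative at most \<open>2 * (p - 1) * (lp_norm p b)\<^sup>2\<close>.
  Combined with the RIP at the three orders it yields the almost orthogonality with constant
  \<open>C_const\<close> (\<open>RIP_pairing_bound\<close>); the two terms of its minimum come from two ways of using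
  smoothness, each optimized over the relative scaling of the two vectors.

  The pairing estimate and the bound on the blocks then give a linear inequality for \<open>norm u\<close>
  with leading coefficient \<open>1 - \<delta> (2*K) - C_const p \<delta> K\<close>, and \<open>norm h\<close> is at most twice \<open>norm u\<close>
  plus twice the approximation error.
\<close>

section \<open>The norm and its duality map\<close>

lemma lp_norm_nonneg [simp]: "0 \<le> lp_norm p u"
  by (simp add: lp_norm_def)

lemma lp_norm_powr:
  assumes "0 < p"
  shows "lp_norm p u powr p = (\<Sum>i\<in>UNIV. \<bar>u $ i\<bar> powr p)"
  using assms by (simp add: lp_norm_def powr_powr sum_nonneg)

lemma lp_norm_eq_0_iff:
  assumes "0 < p"
  shows "lp_norm p u = 0 \<longleftrightarrow> u = 0"
  by (auto simp: lp_norm_def vec_eq_iff sum_nonneg_eq_0_iff)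

lemma lp_norm_scale:
  assumes "0 < p"
  shows "lp_norm p (c *\<^sub>R u) = \<bar>c\<bar> * lp_norm p u"
proof -
  have "(\<Sum>i\<in>UNIV. \<bar>(c *\<^sub>R u) $ i\<bar> powr p) = \<bar>c\<bar> powr p * (\<Sum>i\<in>UNIV. \<bar>u $ i\<bar> powr p)"
    by (simp add: abs_mult powr_mult sum_distrib_left)
  then show ?thesis
    using assms by (simp add: lp_norm_def powr_mult powr_powr sum_nonneg)
qed

lemma lp_norm_minus [simp]: "lp_norm p (- u) = lp_norm p u"
  by (simp add: lp_norm_def)

text \<open>
  Hoelder's inequality, with the conjugate exponents entering as weights \<open>\<alpha>\<close> and \<open>\<beta>\<close>: apply
  Young's inequality to each pair of terms, normalized by the two totals, and add up.
\<close>

lemma Holder_sum: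
  fixes f g :: "'a \<Rightarrow> real"
  assumes "0 < \<alpha>" "0 < \<beta>" "\<alpha> + \<beta> = 1"
    and f: "\<And>i. i \<in> I \<Longrightarrow> 0 \<le> f i" and g: "\<And>i. i \<in> I \<Longrightarrow> 0 \<le> g i"
  shows "(\<Sum>i\<in>I. f i powr \<alpha> * g i powr \<beta>) \<le> (\<Sum>i\<in>I. f i) powr \<alpha> * (\<Sum>i\<in>I. g i) powr \<beta>"
proof (cases "finite I")
  case fin: True
  let ?F = "\<Sum>i\<in>I. f i" and ?G = "\<Sum>i\<in>I. g i"
  show ?thesis
  proof (cases "?F = 0 \<or> ?G = 0")
    case True
    then have "(\<forall>i\<in>I. f i = 0) \<or> (\<forall>i\<in>I. g i = 0)"
      using sum_nonneg_eq_0_iff[OF fin, of f] sum_nonneg_eq_0_iff[OF fin, of g] f g by auto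
    then have "(\<Sum>i\<in>I. f i powr \<alpha> * g i powr \<beta>) = 0"
      by (intro sum.neutral) auto
    then show ?thesis by simp
  next
    case False
    then have F: "0 < ?F" and G: "0 < ?G"
      using sum_nonneg[of I f] sum_nonneg[of I g] f g by fastforce+
    have young: "f i powr \<alpha> * g i powr \<beta> \<le>
        (\<alpha> * (f i / ?F) + \<beta> * (g i / ?G)) * (?F powr \<alpha> * ?G powr \<beta>)" if i: "i \<in> I" for i
    proof (cases "f i = 0 \<or> g i = 0")
      case True
      then show ?thesis using f[OF i] g[OF i] assms F G by auto
    next
      case False
      then have pos: "0 < f i / ?F" "0 < g i / ?G"
        using f[OF i] g[OF i] F G by auto
      have "(f i / ?F) powr \<alpha> * (g i / ?G) powr \<beta> \<le> \<alpha> * (f i / ?F) + \<beta> * (g i / ?G)"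
        using Youngs_inequality_0[OF _ _ _ pos] assms by simp
      then have "(f i / ?F) powr \<alpha> * (g i / ?G) powr \<beta> * (?F powr \<alpha> * ?G powr \<beta>)
          \<le> (\<alpha> * (f i / ?F) + \<beta> * (g i / ?G)) * (?F powr \<alpha> * ?G powr \<beta>)"
        by (intro mult_right_mono) auto
      moreover have "(f i / ?F) powr \<alpha> * (g i / ?G) powr \<beta> * (?F powr \<alpha> * ?G powr \<beta>)
          = f i powr \<alpha> * g i powr \<beta>"
        using F G f[OF i] g[OF i] by (simp add: powr_divide)
      ultimately show ?thesis by simp
    qed
    have "(\<Sum>i\<in>I. f i powr \<alpha> * g i powr \<beta>)
        \<le> (\<Sum>i\<in>I. (\<alpha> * (f i / ?F) + \<beta> * (g i / ?G)) * (?F powr \<alpha> * ?G powr \<beta>))"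
      by (intro sum_mono young)
    also have "\<dots> = (\<alpha> * (?F / ?F) + \<beta> * (?G / ?G)) * (?F powr \<alpha> * ?G powr \<beta>)"
      by (simp only: sum_distrib_right[symmetric] sum.distrib sum_distrib_left[symmetric]
          sum_divide_distrib[symmetric])
    also have "\<dots> = ?F powr \<alpha> * ?G powr \<beta>"
      using F G assms by simp
    finally show ?thesis .
  qed
qed simp

text \<open>
  Half the gradient of \<open>a \<mapsto> (lp_norm p a)\<^sup>2\<close>, i.e. the \<open>J\<close> of the introduction. The factor
  \<open>a $ i * \<bar>a $ i\<bar> powr (p - 2)\<close> stands for \<open>sgn (a $ i) * \<bar>a $ i\<bar> powr (p - 1)\<close>: in this form its
  derivative is a multiple of \<open>\<bar>a $ i\<bar> powr (p - 2)\<close> without any sign. It gives the identity map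
  for \<open>p = 2\<close> even at entries \<open>0\<close>, where \<open>0 powr 0 = 0\<close>.
\<close>

definition duality_map :: "real \<Rightarrow> real ^ 'n \<Rightarrow> real ^ 'n" where
  "duality_map p a = (\<chi> i. lp_norm p a powr (2 - p) * (a $ i * \<bar>a $ i\<bar> powr (p - 2)))"

lemma duality_map_inner:
  "duality_map p a \<bullet> b =
     lp_norm p a powr (2 - p) * (\<Sum>i\<in>UNIV. b $ i * (a $ i * \<bar>a $ i\<bar> powr (p - 2)))"
  by (simp add: duality_map_def inner_vec_def sum_distrib_left mult_ac)

lemma abs_mult_powr:
  fixes x :: real
  shows "\<bar>x\<bar> * \<bar>x\<bar> powr r = \<bar>x\<bar> powr (r + 1)"
  by (cases "x = 0") (simp_all add: powr_add)

lemma mult_mult_powr: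
  fixes x :: real
  shows "x * (x * \<bar>x\<bar> powr (r - 2)) = \<bar>x\<bar> powr r"
proof -
  have "x * (x * \<bar>x\<bar> powr (r - 2)) = \<bar>x\<bar> * (\<bar>x\<bar> * \<bar>x\<bar> powr (r - 2))"
    by (metis abs_mult_self_eq mult.assoc)
  also have "\<dots> = \<bar>x\<bar> powr r"
    unfolding abs_mult_powr by simp
  finally show ?thesis .
qed

lemma duality_map_inner_self:
  assumes "0 < p"
  shows "duality_map p a \<bullet> a = (lp_norm p a)\<^sup>2"
proof (cases "a = 0")
  case True
  then show ?thesis by (simp add: lp_norm_def)
next
  case False
  then have "0 < lp_norm p a"
    using lp_norm_eq_0_iff[OF assms, of a] lp_norm_nonneg[of p a] by linarith
  have "duality_map p a \<bullet> a = lp_norm p a powr (2 - p) * lp_norm p a powr p"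
    by (simp add: duality_map_inner mult_mult_powr lp_norm_powr[OF assms])
  also have "\<dots> = lp_norm p a powr 2"
    by (simp add: powr_add[symmetric])
  finally show ?thesis
    using \<open>0 < lp_norm p a\<close> by simp
qed

text \<open>
  Hoelder's inequality with weights \<open>(p - 1) / p\<close> and \<open>1 / p\<close>; the normalizing power \<open>2 - p\<close> in the
  duality map makes the right-hand side homogeneous of degree one in \<open>a\<close>.
\<close>

lemma duality_map_inner_le:
  assumes "1 < p"
  shows "duality_map p a \<bullet> b \<le> lp_norm p a * lp_norm p b"
proof (cases "a = 0")
  case True
  then show ?thesis by (simp add: duality_map_inner)
next
  case False
  then have pos: "0 < lp_norm p a"
    using lp_norm_eq_0_iff[of p a] lp_norm_nonneg[of p a] assms by linarith
  let ?F = "\<Sum>i\<in>UNIV. \<bar>a $ i\<bar> powr p" and ?G = "\<Sum>i\<in>UNIV. \<bar>b $ i\<bar> powr p"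
  have "(\<Sum>i\<in>UNIV. b $ i * (a $ i * \<bar>a $ i\<bar> powr (p - 2)))
      \<le> (\<Sum>i\<in>UNIV. (\<bar>a $ i\<bar> powr p) powr ((p - 1) / p) * (\<bar>b $ i\<bar> powr p) powr (1 / p))"
  proof (rule sum_mono)
    fix i
    have "b $ i * (a $ i * \<bar>a $ i\<bar> powr (p - 2)) \<le> \<bar>b $ i\<bar> * (\<bar>a $ i\<bar> * \<bar>a $ i\<bar> powr (p - 2))"
      using abs_ge_self[of "b $ i * (a $ i * \<bar>a $ i\<bar> powr (p - 2))"] by (simp add: abs_mult)
    also have "\<dots> = \<bar>b $ i\<bar> * \<bar>a $ i\<bar> powr (p - 1)"
      unfolding abs_mult_powr by simp
    finally show "b $ i * (a $ i * \<bar>a $ i\<bar> powr (p - 2))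
        \<le> (\<bar>a $ i\<bar> powr p) powr ((p - 1) / p) * (\<bar>b $ i\<bar> powr p) powr (1 / p)"
      using assms by (simp add: powr_powr mult.commute)
  qed
  also have "\<dots> \<le> ?F powr ((p - 1) / p) * ?G powr (1 / p)"
    using assms by (intro Holder_sum) (auto simp: field_simps)
  also have "\<dots> = lp_norm p a powr (p - 1) * lp_norm p b"
    using assms by (simp add: lp_norm_def powr_powr)
  finally have "duality_map p a \<bullet> b
      \<le> lp_norm p a powr (2 - p) * (lp_norm p a powr (p - 1) * lp_norm p b)"
    unfolding duality_map_inner by (intro mult_left_mono) auto
  also have "\<dots> = lp_norm p a * lp_norm p b"
    using pos by (simp add: mult.assoc[symmetric] powr_add[symmetric])
  finally show ?thesis .
qed

text \<open>
  Minkowski's inequality, read off from duality: \<open>a + b\<close> attains equality when paired with its own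
  image under the duality map, and that pairing is additive in \<open>a\<close> and \<open>b\<close>.
\<close>

lemma lp_norm_triangle:
  assumes "1 < p"
  shows "lp_norm p (a + b) \<le> lp_norm p a + lp_norm p b"
proof (cases "lp_norm p (a + b) = 0")
  case False
  then have pos: "0 < lp_norm p (a + b)"
    using lp_norm_nonneg[of p "a + b"] by linarith
  have "lp_norm p (a + b) * lp_norm p (a + b) = duality_map p (a + b) \<bullet> (a + b)"
    using assms by (simp add: duality_map_inner_self power2_eq_square)
  also have "\<dots> \<le> lp_norm p (a + b) * (lp_norm p a + lp_norm p b)"
    using duality_map_inner_le[OF assms, of "a + b" a] duality_map_inner_le[OF assms, of "a + b" b]
    by (simp add: inner_add_right distrib_left)
  finally show ?thesis using pos by simp
qed (simp add: add_nonneg_nonneg)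

section \<open>Uniform smoothness\<close>

text \<open>
  The point of allowing \<open>x = 0\<close> is that coordinates may vanish along a segment while the vector
  does not. At \<open>0\<close> the difference quotient is \<open>\<bar>h\<bar> powr r\<close>, which tends to \<open>0\<close> because \<open>0 < r\<close>.
\<close>

lemma has_real_derivative_mult_abs_powr:
  fixes x r :: real
  assumes "0 < r"
  shows "((\<lambda>x. x * \<bar>x\<bar> powr r) has_real_derivative (r + 1) * \<bar>x\<bar> powr r) (at x)"
proof (cases "x = 0")
  case True
  have "((\<lambda>h::real. \<bar>h\<bar> powr r) \<longlongrightarrow> 0) (at 0)"
    using assms by (intro tendsto_zero_powrI) (auto intro!: tendsto_eq_intros tendsto_rabs_zero)
  then have "((\<lambda>h::real. (h * \<bar>h\<bar> powr r) / h) \<longlongrightarrow> 0) (at 0)"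
    by (rule Lim_transform_eventually) (auto simp: eventually_at_filter)
  then show ?thesis
    using True by (simp add: DERIV_def)
next
  case False
  \<comment> \<open>As \<open>z\<^sup>2\<close> is smooth, and positive away from \<open>0\<close>, this avoids splitting on the sign of \<open>x\<close>.\<close>
  have abs_powr: "\<bar>z\<bar> powr r = (z\<^sup>2) powr (r / 2)" for z :: real
  proof (cases "z = 0")
    case False
    then have "z\<^sup>2 = \<bar>z\<bar> powr 2" by simp
    then show ?thesis by (simp only: powr_powr) simp
  qed simp
  have "((\<lambda>z. z\<^sup>2) has_real_derivative 2 * x) (at x)"
    by (auto intro!: derivative_eq_intros)
  then have "((\<lambda>z. (z\<^sup>2) powr (r / 2)) has_real_derivative
      r / 2 * (x\<^sup>2) powr (r / 2 - 1) * (2 * x)) (at x)"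
    using False by (intro DERIV_chain2[OF has_real_derivative_powr]) auto
  then have "((\<lambda>z. z * (z\<^sup>2) powr (r / 2)) has_real_derivative
      1 * (x\<^sup>2) powr (r / 2) + r / 2 * (x\<^sup>2) powr (r / 2 - 1) * (2 * x) * x) (at x)"
    by (intro DERIV_mult DERIV_ident)
  moreover have "r / 2 * (x\<^sup>2) powr (r / 2 - 1) * (2 * x) * x = r * (x\<^sup>2) powr (r / 2)"
    using abs_mult_powr[of "x\<^sup>2" "r / 2 - 1"] by (simp add: power2_eq_square mult_ac)
  ultimately have "((\<lambda>z. z * (z\<^sup>2) powr (r / 2)) has_real_derivative
      (r + 1) * (x\<^sup>2) powr (r / 2)) (at x)"
    by (elim DERIV_cong) (simp only: distrib_right mult_1 add.commute)
  then show ?thesis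
    by (simp only: abs_powr)
qed

lemma has_real_derivative_abs_powr:
  fixes x r :: real
  assumes "2 < r"
  shows "((\<lambda>x. \<bar>x\<bar> powr r) has_real_derivative r * (x * \<bar>x\<bar> powr (r - 2))) (at x)"
proof -
  have "((\<lambda>x. x * (x * \<bar>x\<bar> powr (r - 2))) has_real_derivative
      1 * (x * \<bar>x\<bar> powr (r - 2)) + ((r - 2 + 1) * \<bar>x\<bar> powr (r - 2)) * x) (at x)"
    using assms by (intro DERIV_mult DERIV_ident has_real_derivative_mult_abs_powr) auto
  then show ?thesis
    by (simp add: mult_mult_powr algebra_simps)
qed

lemma second_order_upper_bound:
  fixes g g' g'' :: "real \<Rightarrow> real"
  assumes "\<And>t. 0 \<le> t \<Longrightarrow> t \<le> 1 \<Longrightarrow> (g has_real_derivative g' t) (at t)"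
    and "\<And>t. 0 \<le> t \<Longrightarrow> t \<le> 1 \<Longrightarrow> (g' has_real_derivative g'' t) (at t)"
    and "\<And>t. 0 \<le> t \<Longrightarrow> t \<le> 1 \<Longrightarrow> g'' t \<le> 2 * c"
  shows "g 1 \<le> g 0 + g' 0 + c"
proof -
  define d where "d m = (if m = 0 then g else if m = 1 then g' else g'')" for m :: nat
  have "\<exists>t>0. t < 1 \<and> g 1 = (\<Sum>m<2. d m 0 / fact m * 1 ^ m) + d 2 t / fact 2 * 1 ^ 2"
  proof (rule Maclaurin)
    show "\<forall>m t. m < 2 \<and> 0 \<le> t \<and> t \<le> 1 \<longrightarrow> DERIV (d m) t :> d (Suc m) t"
      using assms(1,2) by (auto simp: d_def less_2_cases_iff)
  qed (auto simp: d_def)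
  then obtain t where "0 < t" "t < 1" "g 1 = g 0 + g' 0 + g'' t / 2"
    by (auto simp: d_def numeral_2_eq_2)
  then show ?thesis
    using assms(3)[of t] by simp
qed

text \<open>
  With \<open>F t\<close> the sum of \<open>p\<close>-th powers along the segment, the squared norm is \<open>F t powr (2 / p)\<close>.
  Its second derivative has a term in \<open>(F' t)\<^sup>2\<close> with the factor \<open>2 / p - 1 \<le> 0\<close>, which can be
  dropped, and a term in \<open>F'' t\<close>, which Hoelder's inequality with weights \<open>1 - 2 / p\<close> and \<open>2 / p\<close>
  bounds so that all powers of \<open>F t\<close> cancel. Strictness of \<open>2 < p\<close> makes the power \<open>p - 2\<close>
  positive, as \<open>has_real_derivative_mult_abs_powr\<close> requires at vanishing coordinates; the segment avoids \<open>0\<close> so that the outer power is smooth.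
\<close>

lemma lp_norm_smooth_segment:
  assumes p: "2 < p" and nz: "\<And>t. 0 \<le> t \<Longrightarrow> t \<le> 1 \<Longrightarrow> a + t *\<^sub>R b \<noteq> 0"
  shows "(lp_norm p (a + b))\<^sup>2 \<le> (lp_norm p a)\<^sup>2 + 2 * (duality_map p a \<bullet> b) + (p - 1) * (lp_norm p b)\<^sup>2"
proof -
  define F where "F t = (\<Sum>i\<in>UNIV. \<bar>a $ i + t * b $ i\<bar> powr p)" for t
  \<comment> \<open>\<open>G\<close> and \<open>H\<close> are the first and second derivative of \<open>F\<close>.\<close>
  define G where
    "G t = (\<Sum>i\<in>UNIV. p * (b $ i * ((a $ i + t * b $ i) * \<bar>a $ i + t * b $ i\<bar> powr (p - 2))))" for t
  define H where
    "H t = (\<Sum>i\<in>UNIV. p * (b $ i * (((p - 1) * \<bar>a $ i + t * b $ i\<bar> powr (p - 2)) * b $ i)))" for t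
  have F_norm: "F t = lp_norm p (a + t *\<^sub>R b) powr p" for t
    using p by (simp add: F_def lp_norm_powr)
  have norm_F: "(lp_norm p (a + t *\<^sub>R b))\<^sup>2 = F t powr (2 / p)" for t
    using p by (simp add: F_norm powr_powr)
  have F_pos: "0 < F t" if "0 \<le> t" "t \<le> 1" for t
    using nz[OF that] p lp_norm_eq_0_iff[of p "a + t *\<^sub>R b"] lp_norm_nonneg[of p "a + t *\<^sub>R b"]
    by (simp add: F_norm)
  have dF: "(F has_real_derivative G t) (at t)" for t
    unfolding F_def G_def using p
    by (intro DERIV_sum DERIV_cong[OF DERIV_chain2[OF has_real_derivative_abs_powr]])
       (auto intro!: derivative_eq_intros)
  have dG: "(G has_real_derivative H t) (at t)" for t
    unfolding G_def H_def using p
    by (intro DERIV_sum DERIV_cmult DERIV_cong[OF DERIV_chain2[OF has_real_derivative_mult_abs_powr]])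
       (auto intro!: derivative_eq_intros)
  have H_le: "H t \<le> p * (p - 1) * (F t powr (1 - 2 / p) * (lp_norm p b)\<^sup>2)" for t
  proof -
    have "(\<Sum>i\<in>UNIV. \<bar>a $ i + t * b $ i\<bar> powr (p - 2) * (b $ i)\<^sup>2)
        = (\<Sum>i\<in>UNIV. (\<bar>a $ i + t * b $ i\<bar> powr p) powr (1 - 2 / p) * (\<bar>b $ i\<bar> powr p) powr (2 / p))"
    proof (intro sum.cong refl)
      fix i
      have "p * (1 - 2 / p) = p - 2" using p by (simp add: field_simps)
      then show "\<bar>a $ i + t * b $ i\<bar> powr (p - 2) * (b $ i)\<^sup>2
          = (\<bar>a $ i + t * b $ i\<bar> powr p) powr (1 - 2 / p) * (\<bar>b $ i\<bar> powr p) powr (2 / p)"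
        using p by (simp add: powr_powr)
    qed
    also have "\<dots> \<le> F t powr (1 - 2 / p) * (\<Sum>i\<in>UNIV. \<bar>b $ i\<bar> powr p) powr (2 / p)"
      unfolding F_def using p by (intro Holder_sum) auto
    also have "(\<Sum>i\<in>UNIV. \<bar>b $ i\<bar> powr p) powr (2 / p) = (lp_norm p b)\<^sup>2"
      using p by (simp add: lp_norm_powr[symmetric] powr_powr)
    finally have *: "(\<Sum>i\<in>UNIV. \<bar>a $ i + t * b $ i\<bar> powr (p - 2) * (b $ i)\<^sup>2)
        \<le> F t powr (1 - 2 / p) * (lp_norm p b)\<^sup>2" .
    have "H t = p * (p - 1) * (\<Sum>i\<in>UNIV. \<bar>a $ i + t * b $ i\<bar> powr (p - 2) * (b $ i)\<^sup>2)"
      unfolding H_def by (simp add: sum_distrib_left power2_eq_square mult_ac)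
    then show ?thesis
      using * p by (simp add: mult_left_mono)
  qed
  define g' where "g' t = 2 / p * F t powr (2 / p - 1) * G t" for t
  define g'' where "g'' t = 2 / p * ((2 / p - 1) * F t powr (2 / p - 2) * G t * G t
      + H t * F t powr (2 / p - 1))" for t
  have "F 1 powr (2 / p) \<le> F 0 powr (2 / p) + g' 0 + (p - 1) * (lp_norm p b)\<^sup>2"
  proof (rule second_order_upper_bound)
    fix t :: real
    assume t: "0 \<le> t" "t \<le> 1"
    show "((\<lambda>t. F t powr (2 / p)) has_real_derivative g' t) (at t)"
      unfolding g'_def by (rule DERIV_chain2[OF has_real_derivative_powr[OF F_pos[OF t]] dF])
    have "((\<lambda>t. F t powr (2 / p - 1)) has_real_derivative
        (2 / p - 1) * F t powr (2 / p - 1 - 1) * G t) (at t)"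
      by (rule DERIV_chain2[OF has_real_derivative_powr[OF F_pos[OF t]] dF])
    then have "((\<lambda>t. 2 / p * (F t powr (2 / p - 1) * G t)) has_real_derivative
        2 / p * ((2 / p - 1) * F t powr (2 / p - 1 - 1) * G t * G t + H t * F t powr (2 / p - 1))) (at t)"
      by (intro DERIV_cmult DERIV_mult dG)
    then show "(g' has_real_derivative g'' t) (at t)"
      unfolding g'_def g''_def by (simp add: mult.assoc)
    have "(2 / p - 1) * F t powr (2 / p - 2) * G t * G t \<le> 0"
      using p by (simp add: mult.assoc mult_nonpos_nonneg)
    then have "g'' t \<le> 2 / p * (H t * F t powr (2 / p - 1))"
      unfolding g''_def using p by (intro mult_left_mono) auto
    also have "\<dots> \<le> 2 / p * (p * (p - 1) * (F t powr (1 - 2 / p) * (lp_norm p b)\<^sup>2) * F t powr (2 / p - 1))"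
      using p H_le[of t] by (intro mult_left_mono mult_right_mono) auto
    also have "\<dots> = 2 * (p - 1) * (lp_norm p b)\<^sup>2 * (F t powr (1 - 2 / p) * F t powr (2 / p - 1))"
      using p by (simp add: mult_ac)
    also have "F t powr (1 - 2 / p) * F t powr (2 / p - 1) = 1"
      using F_pos[OF t] by (simp add: powr_add[symmetric])
    finally show "g'' t \<le> 2 * ((p - 1) * (lp_norm p b)\<^sup>2)"
      by (simp only: mult.assoc mult_1_right)
  qed
  moreover have "g' 0 = 2 * (duality_map p a \<bullet> b)"
  proof -
    have "F 0 powr (2 / p - 1) = lp_norm p a powr (2 - p)"
    proof -
      have "p * (2 / p - 1) = 2 - p" using p by (simp add: field_simps)
      then show ?thesis by (simp add: F_norm powr_powr)
    qed
    then show ?thesis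
      using p unfolding g'_def duality_map_inner
      by (simp add: G_def sum_distrib_left[symmetric])
  qed
  ultimately show ?thesis
    using norm_F[of 1] norm_F[of 0] by simp
qed

text \<open>
  The two cases excluded in the previous lemma are elementary: if the segment from \<open>a\<close> to \<open>a + b\<close>
  meets \<open>0\<close>, then \<open>a\<close> is a multiple of \<open>b\<close> and the claim is one about real numbers, and for \<open>p = 2\<close>
  it is the expansion of a square in an inner product space.
\<close>

lemma lp_norm_smooth:
  assumes p: "2 \<le> p"
  shows "(lp_norm p (a + b))\<^sup>2 \<le> (lp_norm p a)\<^sup>2 + 2 * (duality_map p a \<bullet> b) + (p - 1) * (lp_norm p b)\<^sup>2"
proof (cases "\<exists>t\<ge>0. t \<le> 1 \<and> a + t *\<^sub>R b = 0")
  case True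
  then obtain t where t: "0 \<le> t" "t \<le> 1" and a: "a = (- t) *\<^sub>R b"
    by (auto simp: add_eq_0_iff2)
  have "duality_map p a \<bullet> b = - t * (lp_norm p b)\<^sup>2"
  proof (cases "t = 0")
    case True
    then show ?thesis using a by (simp add: duality_map_inner)
  next
    case False
    have "(lp_norm p a)\<^sup>2 = (- t) * (duality_map p a \<bullet> b)"
      using duality_map_inner_self[of p a] p a by (metis inner_scaleR_right not_numeral_le_zero linorder_not_le order_trans zero_le_numeral)
    moreover have "(lp_norm p a)\<^sup>2 = t * (t * (lp_norm p b)\<^sup>2)"
      using p unfolding a by (subst lp_norm_scale) (auto simp: power_mult_distrib power2_eq_square mult_ac)
    ultimately have "t * (duality_map p a \<bullet> b) = t * (- t * (lp_norm p b)\<^sup>2)" by simp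
    then show ?thesis using False by (simp only: mult_cancel_left) simp
  qed
  moreover have "a + b = (1 - t) *\<^sub>R b"
    using a by (simp add: scaleR_left_diff_distrib)
  moreover have "((1 - t) * lp_norm p b)\<^sup>2 \<le> (t * lp_norm p b)\<^sup>2 + 2 * (- t * (lp_norm p b)\<^sup>2)
      + (p - 1) * (lp_norm p b)\<^sup>2"
  proof -
    have "0 \<le> (p - 2) * (lp_norm p b)\<^sup>2" using p by simp
    then show ?thesis by (simp add: algebra_simps power2_eq_square)
  qed
  ultimately show ?thesis
    using p t a lp_norm_scale[of p "1 - t" b] lp_norm_scale[of p "- t" b] by simp
next
  case False
  show ?thesis
  proof (cases "p = 2")
    case True
    have "duality_map 2 a \<bullet> b = a \<bullet> b"
    proof (cases "a = 0")
      case False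
      then have "duality_map 2 a = a"
        by (simp add: duality_map_def vec_eq_iff lp_norm_2_eq_norm)
      then show ?thesis by simp
    qed (simp add: duality_map_inner)
    then show ?thesis
      using True by (simp add: lp_norm_2_eq_norm power2_norm_eq_inner inner_add_left inner_add_right inner_commute)
  next
    case False
    then show ?thesis
      using p \<open>\<not> (\<exists>t\<ge>0. t \<le> 1 \<and> a + t *\<^sub>R b = 0)\<close> by (intro lp_norm_smooth_segment) auto
  qed
qed

section \<open>Almost orthogonality of disjointly supported sparse vectors\<close>

text \<open>
  The optimal choice is \<open>t = X / B\<close>, the minimizer of \<open>A + t\<^sup>2 * B - 2 * (t * X)\<close>.
\<close>

lemma le_sqrt_of_quadratic:
  fixes A B X :: real
  assumes "0 \<le> A" "0 \<le> B" and q: "\<And>t. 0 < t \<Longrightarrow> 2 * (t * X) \<le> A + t\<^sup>2 * B"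
  shows "X \<le> sqrt (A * B)"
proof (cases "X \<le> 0")
  case True
  then show ?thesis using assms by (meson mult_nonneg_nonneg order_trans real_sqrt_ge_zero)
next
  case False
  show ?thesis
  proof (cases "B = 0")
    case True
    \<comment> \<open>The right side is constant in \<open>t\<close>, while this \<open>t\<close> makes the left side \<open>2 * (A + 1)\<close>.\<close>
    then have False
      using q[of "(A + 1) / X"] False \<open>0 \<le> A\<close> by simp
    then show ?thesis ..
  next
    case B: False
    then have "2 * (X / B * X) \<le> A + (X / B)\<^sup>2 * B"
      using False \<open>0 \<le> B\<close> by (intro q) auto
    then have "X\<^sup>2 \<le> A * B"
      using B \<open>0 \<le> B\<close> by (simp add: field_simps power2_eq_square)
    then show ?thesis by (rule real_le_rsqrt)
  qed
qed

lemma RIP_square: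
  assumes "RIP p \<Phi> \<mu> s \<delta>" "sparse s u"
  shows "\<mu>\<^sup>2 * ((1 - \<delta>) * (norm u)\<^sup>2) \<le> (lp_norm p (\<Phi> *v u))\<^sup>2"
    and "(lp_norm p (\<Phi> *v u))\<^sup>2 \<le> \<mu>\<^sup>2 * ((1 + \<delta>) * (norm u)\<^sup>2)"
proof -
  have \<mu>: "0 < \<mu>" and \<delta>: "0 < \<delta>" "\<delta> < 1"
    and lo: "\<mu> * sqrt (1 - \<delta>) * norm u \<le> lp_norm p (\<Phi> *v u)"
    and hi: "lp_norm p (\<Phi> *v u) \<le> \<mu> * sqrt (1 + \<delta>) * norm u"
    using assms by (auto simp: RIP_def)
  show "\<mu>\<^sup>2 * ((1 - \<delta>) * (norm u)\<^sup>2) \<le> (lp_norm p (\<Phi> *v u))\<^sup>2"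
    using power_mono[OF lo, of 2] \<mu> \<delta> by (simp add: power_mult_distrib mult.assoc)
  show "(lp_norm p (\<Phi> *v u))\<^sup>2 \<le> \<mu>\<^sup>2 * ((1 + \<delta>) * (norm u)\<^sup>2)"
    using power_mono[OF hi, of 2] \<mu> \<delta> by (simp add: power_mult_distrib mult.assoc)
qed

lemma sparse_add:
  assumes "sparse s u" "sparse s' v"
  shows "sparse (s + s') (u + v)"
proof -
  have "card {i. (u + v) $ i \<noteq> 0} \<le> card ({i. u $ i \<noteq> 0} \<union> {i. v $ i \<noteq> 0})"
    by (intro card_mono) auto
  also have "\<dots> \<le> card {i. u $ i \<noteq> 0} + card {i. v $ i \<noteq> 0}"
    by (rule card_Un_le)
  finally show ?thesis using assms by (simp add: sparse_def)
qed

lemma sparse_scale: "sparse s v \<Longrightarrow> sparse s (c *\<^sub>R v)"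
  by (cases "c = 0") (simp_all add: sparse_def)

text \<open>
  Put \<open>a = \<Phi> *v u\<close> and \<open>b = t *\<^sub>R (\<Phi> *v v)\<close>. Smoothness gives
  \<open>2 * (J a \<bullet> b) \<le> (lp_norm p a)\<^sup>2 - (lp_norm p (a - b))\<^sup>2 + (p - 1) * (lp_norm p b)\<^sup>2\<close>, and the RIP at
  the orders \<open>s\<close>, \<open>s + s'\<close> and \<open>s'\<close> bounds the three terms; optimizing over \<open>t\<close> gives the first
  estimate.

  For the second, smoothness is also applied with base point \<open>- a\<close> and increment \<open>a + b\<close>, which
  gives \<open>(lp_norm p b)\<^sup>2 \<le> - (lp_norm p a)\<^sup>2 - 2 * (J a \<bullet> b) + (p - 1) * (lp_norm p (a + b))\<^sup>2\<close>.
  Adding the two inequalities cancels \<open>(lp_norm p a)\<^sup>2\<close>, so that \<open>a + b\<close> and \<open>a - b\<close> are compared at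
  the same order \<open>s + s'\<close>, as in the parallelogram argument for \<open>p = 2\<close>.
\<close>

lemma RIP_pairing_bound:
  fixes \<Phi> :: "real ^ 'n ^ 'm"
  assumes p: "2 \<le> p"
    and u: "RIP p \<Phi> \<mu> s \<delta>1" "sparse s u"
    and v: "RIP p \<Phi> \<mu> s' \<delta>2" "sparse s' v"
    and uv: "RIP p \<Phi> \<mu> (s + s') \<delta>3" "u \<bullet> v = 0"
  defines "X \<equiv> duality_map p (\<Phi> *v u) \<bullet> (\<Phi> *v v)"
  shows "X \<le> \<mu>\<^sup>2 * sqrt ((\<delta>1 + \<delta>3) * (\<delta>2 + \<delta>3 + (p - 2) * (1 + \<delta>2))) * (norm u * norm v)" (is ?thesis1)
    and "X \<le> \<mu>\<^sup>2 * sqrt ((\<delta>3 + (p - 2) * ((1 + \<delta>3) / 2)) * (\<delta>3 + (p - 2) * ((2 + \<delta>2 + \<delta>3) / 2)))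
      * (norm u * norm v)" (is ?thesis2)
proof -
  have \<mu>: "0 < \<mu>" and \<delta>: "0 < \<delta>1" "0 < \<delta>2" "0 < \<delta>3"
    using assms by (auto simp: RIP_def)
  let ?a = "\<Phi> *v u" and ?b = "\<Phi> *v v"
  let ?U = "(norm u)\<^sup>2" and ?V = "(norm v)\<^sup>2"
  have pyth: "(norm (u + t *\<^sub>R v))\<^sup>2 = ?U + t\<^sup>2 * ?V" for t
    unfolding power2_norm_eq_inner using uv(2)
    by (simp add: inner_add_left inner_add_right inner_commute power2_eq_square)
  have comb: "\<Phi> *v (u + t *\<^sub>R v) = ?a + t *\<^sub>R ?b" for t
    by (simp add: matrix_vector_right_distrib matrix_vector_mult_scaleR)
  have sp: "sparse (s + s') (u + t *\<^sub>R v)" for t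
    by (intro sparse_add sparse_scale u(2) v(2))
  have lo: "\<mu>\<^sup>2 * ((1 - \<delta>3) * (?U + t\<^sup>2 * ?V)) \<le> (lp_norm p (?a + t *\<^sub>R ?b))\<^sup>2" for t
    using RIP_square(1)[OF uv(1) sp[of t]] by (simp add: pyth comb)
  have hi: "(lp_norm p (?a + t *\<^sub>R ?b))\<^sup>2 \<le> \<mu>\<^sup>2 * ((1 + \<delta>3) * (?U + t\<^sup>2 * ?V))" for t
    using RIP_square(2)[OF uv(1) sp[of t]] by (simp add: pyth comb)
  have hi_u: "(lp_norm p ?a)\<^sup>2 \<le> \<mu>\<^sup>2 * ((1 + \<delta>1) * ?U)"
    using RIP_square(2)[OF u] .
  have hi_v: "r * (t\<^sup>2 * (lp_norm p ?b)\<^sup>2) \<le> r * (t\<^sup>2 * (\<mu>\<^sup>2 * ((1 + \<delta>2) * ?V)))" if "0 \<le> r" for r t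
    using RIP_square(2)[OF v] that by (intro mult_left_mono) auto
  have smooth_minus: "(lp_norm p (?a + (- t) *\<^sub>R ?b))\<^sup>2
      \<le> (lp_norm p ?a)\<^sup>2 - 2 * (t * X) + (p - 1) * (t\<^sup>2 * (lp_norm p ?b)\<^sup>2)" for t
    using lp_norm_smooth[OF p, of ?a "(- t) *\<^sub>R ?b"] lp_norm_scale[of p "- t" ?b] p
    by (simp add: X_def power_mult_distrib)
  have conclude: "X \<le> \<mu>\<^sup>2 * sqrt (A * B) * (norm u * norm v)"
    if "0 \<le> A" "0 \<le> B"
      and q: "\<And>t. 0 < t \<Longrightarrow> 2 * (t * X) \<le> \<mu>\<^sup>2 * A * ?U + t\<^sup>2 * (\<mu>\<^sup>2 * B * ?V)" for A B
  proof -
    have "X \<le> sqrt ((\<mu>\<^sup>2 * A * ?U) * (\<mu>\<^sup>2 * B * ?V))"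
      using that by (intro le_sqrt_of_quadratic) auto
    also have "(\<mu>\<^sup>2 * A * ?U) * (\<mu>\<^sup>2 * B * ?V) = (\<mu>\<^sup>2 * (norm u * norm v))\<^sup>2 * (A * B)"
      by (simp add: power2_eq_square mult_ac)
    also have "sqrt \<dots> = \<mu>\<^sup>2 * sqrt (A * B) * (norm u * norm v)"
      using \<mu> by (simp add: real_sqrt_mult mult_ac)
    finally show ?thesis .
  qed
  show ?thesis1
  proof (rule conclude)
    fix t :: real assume "0 < t"
    show "2 * (t * X) \<le> \<mu>\<^sup>2 * (\<delta>1 + \<delta>3) * ?U
        + t\<^sup>2 * (\<mu>\<^sup>2 * (\<delta>2 + \<delta>3 + (p - 2) * (1 + \<delta>2)) * ?V)"
      using smooth_minus[of t] lo[of "- t"] hi_u hi_v[of "p - 1" t] p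
      by (simp add: algebra_simps)
  qed (use \<delta> p in auto)
  show ?thesis2
  proof (rule conclude)
    fix t :: real assume "0 < t"
    have "(lp_norm p (- ?a + (?a + t *\<^sub>R ?b)))\<^sup>2 \<le> (lp_norm p (- ?a))\<^sup>2
        + 2 * (duality_map p (- ?a) \<bullet> (?a + t *\<^sub>R ?b)) + (p - 1) * (lp_norm p (?a + t *\<^sub>R ?b))\<^sup>2"
      by (rule lp_norm_smooth[OF p])
    moreover have "duality_map p (- ?a) = - duality_map p ?a"
      by (simp add: duality_map_def vec_eq_iff)
    moreover have "duality_map p ?a \<bullet> ?a = (lp_norm p ?a)\<^sup>2"
      using p by (intro duality_map_inner_self) simp
    ultimately have "t\<^sup>2 * (lp_norm p ?b)\<^sup>2 \<le> - (lp_norm p ?a)\<^sup>2 - 2 * (t * X)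
        + (p - 1) * (lp_norm p (?a + t *\<^sub>R ?b))\<^sup>2"
      using p by (simp add: lp_norm_scale power_mult_distrib inner_add_right X_def)
    moreover have "(p - 1) * (lp_norm p (?a + t *\<^sub>R ?b))\<^sup>2
        \<le> (p - 1) * (\<mu>\<^sup>2 * ((1 + \<delta>3) * (?U + t\<^sup>2 * ?V)))"
      using hi[of t] p by (intro mult_left_mono) auto
    ultimately show "2 * (t * X) \<le> \<mu>\<^sup>2 * (\<delta>3 + (p - 2) * ((1 + \<delta>3) / 2)) * ?U
        + t\<^sup>2 * (\<mu>\<^sup>2 * (\<delta>3 + (p - 2) * ((2 + \<delta>2 + \<delta>3) / 2)) * ?V)"
      using smooth_minus[of t] lo[of "- t"] hi_v[of "p - 2" t] p
      by (simp add: field_simps)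
  qed (use \<delta> p in \<open>auto intro!: add_nonneg_nonneg mult_nonneg_nonneg\<close>)
qed

section \<open>Block decomposition\<close>

definition restrict_vec :: "'n set \<Rightarrow> real ^ 'n \<Rightarrow> real ^ 'n" where
  "restrict_vec T h = (\<chi> i. if i \<in> T then h $ i else 0)"

lemma restrict_vec_nth [simp]: "restrict_vec T h $ i = (if i \<in> T then h $ i else 0)"
  by (simp add: restrict_vec_def)

lemma sparse_restrict_vec:
  assumes "card T \<le> s"
  shows "sparse s (restrict_vec T h)"
proof -
  have "card {i. restrict_vec T h $ i \<noteq> 0} \<le> card T"
    by (intro card_mono) auto
  then show ?thesis using assms by (simp add: sparse_def)
qed

lemma restrict_vec_Un:
  assumes "S \<inter> T = {}"
  shows "restrict_vec (S \<union> T) h = restrict_vec S h + restrict_vec T h"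
  using assms by (auto simp: vec_eq_iff)

lemma norm_restrict_vec_sq: "(norm (restrict_vec T h))\<^sup>2 = (\<Sum>i\<in>T. (h $ i)\<^sup>2)"
  unfolding power2_norm_eq_inner inner_vec_def
  by (simp add: power2_eq_square if_distrib[of "\<lambda>x. x * _"] sum.If_cases cong: if_cong)

lemma norm_restrict_vec_mono:
  assumes "S \<subseteq> T"
  shows "norm (restrict_vec S h) \<le> norm (restrict_vec T h)"
  by (rule power2_le_imp_le) (auto simp: norm_restrict_vec_sq intro!: sum_mono2[OF _ assms])

lemma sum_abs_le_sqrt_card_norm:
  assumes "card T \<le> K"
  shows "(\<Sum>i\<in>T. \<bar>h $ i\<bar>) \<le> sqrt (real K) * norm (restrict_vec T h)"
proof (rule power2_le_imp_le)
  have "(\<Sum>i\<in>T. \<bar>h $ i\<bar>)\<^sup>2 \<le> (\<Sum>i\<in>T. (h $ i)\<^sup>2) * real (card T)"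
    using Cauchy_Schwarz_ineq_sum[of "\<lambda>i. \<bar>h $ i\<bar>" "\<lambda>_. 1" T] by simp
  also have "\<dots> \<le> (\<Sum>i\<in>T. (h $ i)\<^sup>2) * real K"
    using assms by (intro mult_left_mono) (auto intro: sum_nonneg)
  finally show "(\<Sum>i\<in>T. \<bar>h $ i\<bar>)\<^sup>2 \<le> (sqrt (real K) * norm (restrict_vec T h))\<^sup>2"
    by (simp add: power_mult_distrib norm_restrict_vec_sq mult.commute)
qed simp

lemma obtain_largest:
  fixes f :: "'a \<Rightarrow> real"
  assumes "finite S" "K \<le> card S"
  obtains T where "T \<subseteq> S" "card T = K" "\<And>i j. i \<in> T \<Longrightarrow> j \<in> S - T \<Longrightarrow> f j \<le> f i"
  using assms(2)
proof (induction K arbitrary: thesis)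
  case 0
  then show ?case by (metis card.empty empty_iff empty_subsetI)
next
  case (Suc K)
  obtain T where T: "T \<subseteq> S" "card T = K" "\<And>i j. i \<in> T \<Longrightarrow> j \<in> S - T \<Longrightarrow> f j \<le> f i"
    using Suc by (metis Suc_leD)
  have fin: "finite (S - T)" "finite T" using assms(1) T(1) finite_subset by auto
  have ne: "S - T \<noteq> {}"
    using Suc.prems(2) T fin card_mono[of T S] by auto
  obtain m where "m \<in> S - T" "f m = Max (f ` (S - T))"
    using Max_in[of "f ` (S - T)"] fin(1) ne by fastforce
  then have m: "m \<in> S - T" "\<And>j. j \<in> S - T \<Longrightarrow> f j \<le> f m"
    using fin(1) by auto
  show ?case
  proof (rule Suc.prems(1)[of "insert m T"])
    show "insert m T \<subseteq> S" "card (insert m T) = Suc K"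
      using T m(1) fin by auto
    show "f j \<le> f i" if "i \<in> insert m T" "j \<in> S - insert m T" for i j
      using that T(3) m by auto
  qed
qed

text \<open>
  Each entry on \<open>T'\<close> is at most the average of the magnitudes on \<open>T\<close>, and at most \<open>K\<close> such entries
  contribute to the norm. This is how the \<open>\<ell>\<^sub>2\<close> norm of a block is traded for the \<open>\<ell>\<^sub>1\<close> norm of the
  preceding one.
\<close>

lemma norm_block_le_previous:
  fixes h :: "real ^ 'n"
  assumes K: "0 < K" and T: "card T = K" and T': "card T' \<le> K"
    and le: "\<And>i j. i \<in> T \<Longrightarrow> j \<in> T' \<Longrightarrow> \<bar>h $ j\<bar> \<le> \<bar>h $ i\<bar>"
  shows "norm (restrict_vec T' h) \<le> (\<Sum>i\<in>T. \<bar>h $ i\<bar>) / sqrt (real K)"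
proof -
  let ?s = "\<Sum>i\<in>T. \<bar>h $ i\<bar>"
  have "\<bar>h $ j\<bar> \<le> ?s / real K" if "j \<in> T'" for j
  proof -
    have "real (card T) * \<bar>h $ j\<bar> \<le> ?s"
      using le that by (intro sum_bounded_below) auto
    then show ?thesis using K T by (simp add: field_simps)
  qed
  then have "(h $ j)\<^sup>2 \<le> (?s / real K)\<^sup>2" if "j \<in> T'" for j
    using that by (metis abs_le_square_iff abs_of_nonneg divide_nonneg_nonneg of_nat_0_le_iff sum_abs_ge_zero)
  then have "(\<Sum>j\<in>T'. (h $ j)\<^sup>2) \<le> real (card T') * (?s / real K)\<^sup>2"
    by (intro sum_bounded_above) auto
  also have "\<dots> \<le> real K * (?s / real K)\<^sup>2"
    using T' by (intro mult_right_mono) auto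
  also have "\<dots> = (?s / sqrt (real K))\<^sup>2"
    using K by (simp add: power_divide power2_eq_square)
  finally show ?thesis
    by (intro power2_le_imp_le[of "norm _"]) (auto simp: norm_restrict_vec_sq intro!: divide_nonneg_nonneg sum_nonneg)
qed

text \<open>
  Induction on the size of \<open>S\<close>: take the \<open>K\<close> largest entries as first block \<open>T\<close> and decompose
  \<open>S - T\<close>, whose own first block becomes the head of the list. Its norm is charged to the
  \<open>\<ell>\<^sub>1\<close> mass of \<open>T\<close>, the other norms to that of \<open>S - T\<close>. The norm of the first block itself does not
  enter the sum: there is no earlier block to charge it to.
\<close>

lemma block_decomposition:
  fixes h :: "real ^ 'n"
  assumes K: "0 < K"
  shows "\<exists>T\<subseteq>S. \<exists>vs. card T \<le> K \<and>
      (\<forall>v\<in>set vs. sparse K v \<and> (\<forall>i. v $ i \<noteq> 0 \<longrightarrow> i \<in> S - T)) \<and>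
      restrict_vec (S - T) h = sum_list vs \<and>
      sum_list (map norm vs) \<le> (\<Sum>i\<in>S. \<bar>h $ i\<bar>) / sqrt (real K)"
proof (induction "card S" arbitrary: S rule: less_induct)
  case less
  show ?case
  proof (cases "K \<le> card S")
    case False
    then show ?thesis
      by (intro exI[of _ S] exI[of _ "[]"] conjI) (auto simp: vec_eq_iff sum_nonneg)
  next
    case True
    obtain T where T: "T \<subseteq> S" "card T = K" "\<And>i j. i \<in> T \<Longrightarrow> j \<in> S - T \<Longrightarrow> \<bar>h $ j\<bar> \<le> \<bar>h $ i\<bar>"
      using obtain_largest[OF _ True, of "\<lambda>i. \<bar>h $ i\<bar>"] by auto
    have "card (S - T) < card S"
      using T K True by (simp add: card_Diff_subset)
    from less[OF this] obtain T' vs where IH: "T' \<subseteq> S - T" "card T' \<le> K"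
      "\<forall>v\<in>set vs. sparse K v \<and> (\<forall>i. v $ i \<noteq> 0 \<longrightarrow> i \<in> S - T - T')"
      "restrict_vec (S - T - T') h = sum_list vs"
      "sum_list (map norm vs) \<le> (\<Sum>i\<in>S - T. \<bar>h $ i\<bar>) / sqrt (real K)"
      by blast
    have "norm (restrict_vec T' h) \<le> (\<Sum>i\<in>T. \<bar>h $ i\<bar>) / sqrt (real K)"
      using IH(1,2) T(3) by (intro norm_block_le_previous K T(2)) auto
    moreover have "(\<Sum>i\<in>S. \<bar>h $ i\<bar>) = (\<Sum>i\<in>S - T. \<bar>h $ i\<bar>) + (\<Sum>i\<in>T. \<bar>h $ i\<bar>)"
      using T(1) by (intro sum.subset_diff) auto
    ultimately have "sum_list (map norm (restrict_vec T' h # vs)) \<le> (\<Sum>i\<in>S. \<bar>h $ i\<bar>) / sqrt (real K)"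
      using IH(5) by (simp add: add_divide_distrib)
    moreover have "restrict_vec (S - T) h = sum_list (restrict_vec T' h # vs)"
      using restrict_vec_Un[of T' "S - T - T'" h] IH(1,4) by (simp add: Un_absorb1)
    moreover have "sparse K (restrict_vec T' h)"
      using IH(2) by (rule sparse_restrict_vec)
    ultimately show ?thesis
      using T IH(1,3)
      by (intro exI[of _ T] exI[of _ "restrict_vec T' h # vs"] conjI) auto
  qed
qed

section \<open>The recovery estimate\<close>

text \<open>
  By the triangle inequality, \<open>x + h\<close> loses at most \<open>\<bar>h $ i\<bar>\<close> on \<open>T\<close> and retains at least
  \<open>\<bar>h $ i\<bar> - \<bar>x $ i\<bar>\<close> off \<open>T\<close>; as its norm does not exceed that of \<open>x\<close>, the mass of \<open>h\<close> off \<open>T\<close> is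
  controlled by the mass of \<open>h\<close> on \<open>T\<close> and of \<open>x\<close> off \<open>T\<close>.
\<close>

lemma l1_cone_inequality:
  fixes x h :: "real ^ 'n"
  assumes "lp_norm 1 (x + h) \<le> lp_norm 1 x"
  shows "(\<Sum>i\<in>- T. \<bar>h $ i\<bar>) \<le> (\<Sum>i\<in>T. \<bar>h $ i\<bar>) + 2 * (\<Sum>i\<in>- T. \<bar>x $ i\<bar>)"
proof -
  have split: "(\<Sum>i\<in>UNIV. f i) = (\<Sum>i\<in>T. f i) + (\<Sum>i\<in>- T. f i)" for f :: "'n \<Rightarrow> real"
    using sum.subset_diff[of T UNIV f] by (simp add: Compl_eq_Diff_UNIV)
  have "(\<Sum>i\<in>T. \<bar>x $ i\<bar> - \<bar>h $ i\<bar>) \<le> (\<Sum>i\<in>T. \<bar>x $ i + h $ i\<bar>)"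
    by (intro sum_mono) auto
  moreover have "(\<Sum>i\<in>- T. \<bar>h $ i\<bar> - \<bar>x $ i\<bar>) \<le> (\<Sum>i\<in>- T. \<bar>x $ i + h $ i\<bar>)"
    by (intro sum_mono) auto
  ultimately show ?thesis
    using assms split[of "\<lambda>i. \<bar>x $ i + h $ i\<bar>"] split[of "\<lambda>i. \<bar>x $ i\<bar>"]
    by (simp add: lp_norm_def sum_nonneg sum_subtractf)
qed

lemma disjoint_support_imp_orthogonal:
  fixes u v :: "real ^ 'n"
  assumes "\<And>i. u $ i = 0 \<or> v $ i = 0"
  shows "u \<bullet> v = 0"
  unfolding inner_vec_def using assms by (intro sum.neutral) auto

lemma RIP_pairing_bound_C_const:
  assumes p: "2 \<le> p" and RIP: "\<forall>s\<in>{K, 2*K, 3*K}. RIP p \<Phi> \<mu> s (\<delta> s)"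
    and u: "sparse (2*K) u" and v: "sparse K v" and "u \<bullet> v = 0"
  shows "duality_map p (\<Phi> *v u) \<bullet> (\<Phi> *v v) \<le> \<mu>\<^sup>2 * C_const p \<delta> K * (norm u * norm v)"
proof -
  have "RIP p \<Phi> \<mu> (2*K + K) (\<delta> (3*K))" using RIP by simp
  note * = RIP_pairing_bound[OF p _ u _ v this \<open>u \<bullet> v = 0\<close>, of "\<delta> (2*K)" "\<delta> K"]
  show ?thesis
    unfolding C_const_def min_def using * RIP by auto
qed

theorem theorem2:
  fixes x xK x_star :: "real ^ 'n" and y n :: "real ^ 'm" and \<Phi> :: "real ^ 'n ^ 'm"
    and p \<mu> \<epsilon> :: real and \<delta> :: "nat \<Rightarrow> real" and K :: nat
  assumes "1 \<le> K" and "K \<le> CARD('n)"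
    and "best_approx K x xK"
    and "2 \<le> p"
    and "\<forall>s\<in>{K, 2*K, 3*K}. RIP p \<Phi> \<mu> s (\<delta> s)"
    and "0 < 1 - \<delta> (2*K) - C_const p \<delta> K"
    and "0 < \<epsilon>"
    and "y = \<Phi> *v x + n" and "lp_norm p n \<le> \<epsilon>"
    and "x_star \<in> BPDQ p \<Phi> y \<epsilon>"
  shows "norm (x_star - x) \<le> A_const p \<delta> K * approx_error K x xK + B_const p \<delta> K * (\<epsilon> / \<mu>)"
proof -
  note p = \<open>2 \<le> p\<close> and RIP = assms(5)
  have RIP2: "RIP p \<Phi> \<mu> (2*K) (\<delta> (2*K))" using RIP by simp
  have \<mu>: "0 < \<mu>" and \<delta>2: "0 < \<delta> (2*K)" "\<delta> (2*K) < 1"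
    using RIP2 by (auto simp: RIP_def)
  have K: "0 < K" using \<open>1 \<le> K\<close> by simp
  define h where "h = x_star - x"
  define C where "C = C_const p \<delta> K"
  define e where "e = approx_error K x xK"
  define D where "D = 1 - \<delta> (2*K) - C"
  define T0 where "T0 = {i. xK $ i \<noteq> 0}"
  have D: "0 < D" using assms(6) by (simp add: D_def C_def)
  have C0: "0 \<le> C"
    using RIP p unfolding C_def C_const_def RIP_def by auto
  have card_T0: "card T0 \<le> K"
    using assms(3) by (simp add: T0_def best_approx_def is_arg_min_def sparse_def)

  obtain T1 vs where T1: "T1 \<subseteq> - T0" "card T1 \<le> K"
    and vs: "\<forall>v\<in>set vs. sparse K v \<and> (\<forall>i. v $ i \<noteq> 0 \<longrightarrow> i \<in> - T0 - T1)"
    and rest: "restrict_vec (- T0 - T1) h = sum_list vs"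
    and tail: "sum_list (map norm vs) \<le> (\<Sum>i\<in>- T0. \<bar>h $ i\<bar>) / sqrt (real K)"
    using block_decomposition[OF K, of "- T0" h] by blast
  define u where "u = restrict_vec (T0 \<union> T1) h"
  define \<sigma> where "\<sigma> = sum_list (map norm vs)"
  have h_split: "h = u + sum_list vs"
    unfolding u_def rest[symmetric] by (auto simp: vec_eq_iff)
  have sp_u: "sparse (2*K) u"
    unfolding u_def using card_Un_le[of T0 T1] card_T0 T1(2)
    by (intro sparse_restrict_vec) linarith

  have feas: "lp_norm p (y - \<Phi> *v x_star) \<le> \<epsilon>"
    and opt: "\<And>z. lp_norm p (y - \<Phi> *v z) \<le> \<epsilon> \<Longrightarrow> lp_norm 1 x_star \<le> lp_norm 1 z"
    using assms(10) by (auto simp: BPDQ_def is_arg_min_linorder)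
  have "lp_norm 1 (x + h) \<le> lp_norm 1 x"
    using opt[of x] assms(8,9) by (simp add: h_def)
  then have cone: "(\<Sum>i\<in>- T0. \<bar>h $ i\<bar>) \<le> (\<Sum>i\<in>T0. \<bar>h $ i\<bar>) + 2 * (\<Sum>i\<in>- T0. \<bar>x $ i\<bar>)"
    by (rule l1_cone_inequality)
  have head: "(\<Sum>i\<in>T0. \<bar>h $ i\<bar>) \<le> sqrt (real K) * norm u"
  proof -
    have "(\<Sum>i\<in>T0. \<bar>h $ i\<bar>) \<le> sqrt (real K) * norm (restrict_vec T0 h)"
      by (rule sum_abs_le_sqrt_card_norm[OF card_T0])
    also have "\<dots> \<le> sqrt (real K) * norm u"
      unfolding u_def by (intro mult_left_mono norm_restrict_vec_mono) auto
    finally show ?thesis .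
  qed
  have off_support: "(\<Sum>i\<in>- T0. \<bar>x $ i\<bar>) \<le> sqrt (real K) * e"
  proof -
    have "(\<Sum>i\<in>- T0. \<bar>x $ i\<bar>) = (\<Sum>i\<in>- T0. \<bar>(x - xK) $ i\<bar>)"
      by (intro sum.cong) (auto simp: T0_def)
    also have "\<dots> \<le> lp_norm 1 (x - xK)"
      by (simp add: lp_norm_def sum_nonneg sum_mono2)
    also have "\<dots> = sqrt (real K) * e"
      using K by (simp add: e_def approx_error_def powr_minus powr_half_sqrt field_simps)
    finally show ?thesis .
  qed
  have \<sigma>_le: "\<sigma> \<le> norm u + 2 * e"
  proof -
    have "sqrt (real K) * \<sigma> \<le> sqrt (real K) * (norm u + 2 * e)"
      using tail cone head off_support K by (simp add: \<sigma>_def field_simps)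
    then show ?thesis using K by simp
  qed

  have image_h: "lp_norm p (\<Phi> *v h) \<le> 2 * \<epsilon>"
  proof -
    have "\<Phi> *v h = n + - (y - \<Phi> *v x_star)"
      using assms(8) by (simp add: h_def matrix_vector_mult_diff_distrib)
    then have "lp_norm p (\<Phi> *v h) \<le> lp_norm p n + lp_norm p (- (y - \<Phi> *v x_star))"
      using lp_norm_triangle[of p] p by simp
    then show ?thesis using feas assms(9) by (simp only: lp_norm_minus)
  qed

  let ?J = "duality_map p (\<Phi> *v u)"
  \<comment> \<open>The pairing bound is one-sided; applied to \<open>- w\<close> it bounds the blocks from the side needed
    when \<open>\<Phi> *v u\<close> is written as \<open>\<Phi> *v h\<close> minus their images.\<close>
  have blocks: "- (?J \<bullet> (\<Phi> *v sum_list ws)) \<le> \<mu>\<^sup>2 * C * norm u * sum_list (map norm ws)"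
    if "set ws \<subseteq> set vs" for ws
    using that
  proof (induction ws)
    case (Cons w ws)
    have "u \<bullet> (- w) = 0"
      using vs Cons.prems by (intro disjoint_support_imp_orthogonal) (auto simp: u_def)
    moreover have "sparse K (- w)"
      using vs Cons.prems by (auto simp: sparse_def)
    ultimately have "?J \<bullet> (\<Phi> *v (- w)) \<le> \<mu>\<^sup>2 * C * (norm u * norm (- w))"
      unfolding C_def by (intro RIP_pairing_bound_C_const p RIP sp_u)
    moreover have "\<Phi> *v (- w) = - (\<Phi> *v w)"
      using matrix_vector_mult_scaleR[of \<Phi> "-1" w] by simp
    ultimately show ?case
      using Cons by (simp add: matrix_vector_right_distrib inner_add_right algebra_simps)
  qed simp
  \<comment> \<open>The residual bound controls the pairing with \<open>\<Phi> *v h\<close>, almost orthogonality the pairing with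
    the blocks.\<close>
  have "\<mu>\<^sup>2 * ((1 - \<delta> (2*K)) * (norm u)\<^sup>2)
      \<le> \<mu> * sqrt (1 + \<delta> (2*K)) * norm u * (2 * \<epsilon>) + \<mu>\<^sup>2 * C * norm u * \<sigma>"
  proof -
    have "\<mu>\<^sup>2 * ((1 - \<delta> (2*K)) * (norm u)\<^sup>2) \<le> (lp_norm p (\<Phi> *v u))\<^sup>2"
      by (rule RIP_square(1)[OF RIP2 sp_u])
    also have "\<dots> = ?J \<bullet> (\<Phi> *v u)"
      using p by (simp add: duality_map_inner_self)
    also have "\<dots> = ?J \<bullet> (\<Phi> *v h) - ?J \<bullet> (\<Phi> *v sum_list vs)"
      by (simp add: h_split matrix_vector_right_distrib inner_add_right)
    also have "?J \<bullet> (\<Phi> *v h) \<le> lp_norm p (\<Phi> *v u) * lp_norm p (\<Phi> *v h)"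
      using p by (intro duality_map_inner_le) simp
    also have "\<dots> \<le> \<mu> * sqrt (1 + \<delta> (2*K)) * norm u * (2 * \<epsilon>)"
      using RIP2 sp_u image_h \<mu> \<delta>2 by (intro mult_mono) (auto simp: RIP_def)
    finally show ?thesis using blocks[of vs] by (simp add: \<sigma>_def)
  qed
  also have "\<dots> \<le> \<mu> * sqrt (1 + \<delta> (2*K)) * norm u * (2 * \<epsilon>) + \<mu>\<^sup>2 * C * norm u * (norm u + 2 * e)"
    using \<sigma>_le C0 \<mu> by (intro add_left_mono mult_left_mono) auto
  finally have "norm u * (\<mu>\<^sup>2 * (D * norm u))
      \<le> norm u * (\<mu>\<^sup>2 * (2 * sqrt (1 + \<delta> (2*K)) * (\<epsilon> / \<mu>) + 2 * C * e))"
    using \<mu> by (simp add: D_def power2_eq_square algebra_simps)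
  moreover have "0 \<le> e"
    by (simp add: e_def approx_error_def)
  \<comment> \<open>Cancelling \<open>norm u\<close> requires it to be nonzero; otherwise the claim says that the right-hand
    side is nonnegative.\<close>
  ultimately have "D * norm u \<le> 2 * sqrt (1 + \<delta> (2*K)) * (\<epsilon> / \<mu>) + 2 * C * e"
    using \<mu> \<delta>2 C0 \<open>0 < \<epsilon>\<close> by (cases "norm u = 0") auto
  then have u_le: "norm u \<le> (2 * sqrt (1 + \<delta> (2*K)) * (\<epsilon> / \<mu>) + 2 * C * e) / D"
    using D by (simp add: field_simps)
  have "norm (sum_list ws) \<le> sum_list (map norm ws)" for ws :: "(real ^ 'n) list"
    by (induction ws) (auto intro: norm_triangle_le)
  then have "norm h \<le> norm u + \<sigma>"
    unfolding h_split \<sigma>_def by (metis add_left_mono norm_triangle_ineq order_trans)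
  also have "\<dots> \<le> 2 * norm u + 2 * e"
    using \<sigma>_le by simp
  also have "\<dots> \<le> 2 * ((2 * sqrt (1 + \<delta> (2*K)) * (\<epsilon> / \<mu>) + 2 * C * e) / D) + 2 * e"
    by (intro add_right_mono mult_left_mono u_le) simp
  also have "\<dots> = 2 * (1 + C - \<delta> (2*K)) / D * e + 4 * sqrt (1 + \<delta> (2*K)) / D * (\<epsilon> / \<mu>)"
  proof -
    have "1 + C - \<delta> (2*K) = 2 * C + D" by (simp add: D_def)
    moreover have "2 * ((2 * a * b + 2 * C * e) / D) + 2 * e
        = 2 * (2 * C + D) / D * e + 4 * a / D * b" for a b
      using D by (simp add: field_simps)
    ultimately show ?thesis by (simp only:)
  qed
  finally show ?thesis
    by (simp add: h_def C_def D_def e_def A_const_def B_const_def)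
qed

end
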